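(* Let $\mathcal{A}$ be the cluster algebra of the once-punctured torus with initial cluster $(x_1,x_2,x_3)$, let $x_1'=(x_2^2+x_3^2)/x_1$, let $u(i)$ be the cluster variable obtained from the initial cluster by the mutation sequence $\mu_1\mu_2\mu_1\mu_2\cdots$ of length $i$, and let $v(i)$ be as in the context. Evaluate at $x_1,x_2,x_3\in\mathbb{R}_{>0}$ and take square roots to be positive. Then: (a) $u(i)/v(i)$ converges as $i\to\infty$ to \[\alpha=\frac{x_1'-x_1+\sqrt{(x_1'-x_1)^2+4x_3^2}}{2x_3}.\] (b) $u(i)/u(i-1)$ converges as $i\to\infty$ to \[\beta=\frac{x_1'+x_1+\sqrt{(x_1'-x_1)^2+4x_3^2}}{2x_2}=\frac{x_3\alpha+x_1}{x_2}.\] (c) Let $z=(x_1'-x_1)/x_3$. Then $\alpha=[\,\overline{z}\,]=[z,z,z,\ldots]$ if $z>0$, and $\alpha=[0,\overline{-z}\,]=[0,-z,-z,\ldots]$ if $z<0$. (d) Equivalently, $\alpha=\Big[\,\overline{\tfrac{x_2^2+x_3^2-x_1^2}{x_1x_3}}\,\Big]$ or $\alpha=\Big[\,0,\overline{\tfrac{x_1^2-x_2^2-x_3^2}{x_1x_3}}\,\Big]$ (in the cases $z>0$, $z<0$ respectively).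
   Context: The cluster algebra of the once-punctured torus has initial cluster $(x_1,x_2,x_3)$ and exchange quiver with two arrows between each pair of vertices, oriented cyclically (Markov quiver), so mutation at $k$ replaces $x_k$ by $x_k'=(x_j^2+x_l^2)/x_k$ in the first step and by the usual exchange relations thereafter. Concretely, $u(i)=x(\mathcal{G}(i))$ where $\mathcal{G}(i)$ is the straight (all tiles in one column) snake graph with $2i-1$ square tiles $G_1,\ldots,G_{2i-1}$, tile $G_j$ labeled $x_1$ for $j$ odd and $x_2$ for $j$ even, all horizontal edges (the south edge $e_0$ of $G_1$, the interior edges shared by consecutive tiles, and the north edge of the last tile) having weight $x_3$, and the vertical edges of a tile labeled $x_1$ (resp. $x_2$) having weight $x_2$ (resp. $x_1$); for such a labeled graph $\mathcal{H}$, $x(\mathcal{H})=\big(\sum_P\prod_{e\in P}\mathrm{wt}(e)\big)/\prod(\text{tile labels})$, summing over perfect matchings $P$. $v(i)=x(\mathcal{G}(i)\setminus\{e_0\})$, where $\mathcal{G}(i)\setminus\{e_0\}$ is the full subgraph on the vertices not incident to $e_0$, i.e. the straight snake graph formed by the tiles $G_2,\ldots,G_{2i-1}$ (the single edge shared by $G_1$ and $G_2$ when $i=1$). Continued fractions: $[r_1,\ldots,r_n]=r_1+1/[r_2,\ldots,r_n]$, $[r_1]=r_1$, and an infinite continued fraction is the limit of its finite truncations; the overline denotes periodic repetition. *)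

theory Defs
  imports Complex_Main "HOL-Computational_Algebra.Polynomial"
    "HOL-Computational_Algebra.Fraction_Field"
begin

text \<open>
  The ambient field is \<open>\<rat>(x\<^sub>1, x\<^sub>2, x\<^sub>3)\<close>, realised as the fraction field of
  \<open>\<int>[x\<^sub>1][x\<^sub>2][x\<^sub>3]\<close>.
\<close>

type_synonym pol3 = "int poly poly poly"
type_synonym ratfun = "pol3 fract"

definition X1 :: ratfun where "X1 = Fract [:[:[:0, 1:]:]:] 1"
definition X2 :: ratfun where "X2 = Fract [:[:0, 1:]:] 1"
definition X3 :: ratfun where "X3 = Fract [:0, 1:] 1"

definition pol_eval :: "real \<Rightarrow> real \<Rightarrow> real \<Rightarrow> pol3 \<Rightarrow> real" where
  "pol_eval a b c p =
     poly (map_poly (\<lambda>q. poly (map_poly (\<lambda>r. poly (map_poly of_int r) a) q) b) p) c"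

text \<open>
  The value of a rational function at a point where it is regular, that is, where it has a
  representation with non-vanishing denominator; the value does not depend on the choice of
  such a representation.  At other points the value is unspecified.
\<close>

definition rat_eval :: "real \<Rightarrow> real \<Rightarrow> real \<Rightarrow> ratfun \<Rightarrow> real" where
  "rat_eval a b c f =
     (THE r. \<exists>p q. f = Fract p q \<and> pol_eval a b c q \<noteq> 0 \<and>
                   r = pol_eval a b c p / pol_eval a b c q)"


text \<open>
  A quiver without loops and 2-cycles is encoded by its skew-symmetric matrix:
  \<open>B i j\<close> is the number of arrows from \<open>i\<close> to \<open>j\<close> minus the number of arrows
  from \<open>j\<close> to \<open>i\<close>.
\<close>

record ('i, 'k) seed =
  arrows :: "'i \<Rightarrow> 'i \<Rightarrow> int"
  cluster :: "'i \<Rightarrow> 'k"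

text \<open>
  Every path \<open>i \<rightarrow> k \<rightarrow> j\<close> contributes an arrow from \<open>i\<close> to \<open>j\<close>, 2-cycles cancel, and
  the arrows at \<open>k\<close> are reversed.
\<close>

definition mutate_arrows :: "'i \<Rightarrow> ('i \<Rightarrow> 'i \<Rightarrow> int) \<Rightarrow> 'i \<Rightarrow> 'i \<Rightarrow> int" where
  "mutate_arrows k B i j =
     (if i = k \<or> j = k then - B i j
      else B i j + max 0 (B i k) * max 0 (B k j) - max 0 (B j k) * max 0 (B k i))"

definition mutate_cluster ::
  "'i set \<Rightarrow> 'i \<Rightarrow> ('i \<Rightarrow> 'i \<Rightarrow> int) \<Rightarrow> ('i \<Rightarrow> 'k::field) \<Rightarrow> 'i \<Rightarrow> 'k" where
  "mutate_cluster I k B x =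
     x(k := ((\<Prod>i\<in>I. x i ^ nat (B i k)) + (\<Prod>i\<in>I. x i ^ nat (B k i))) / x k)"

definition mutate :: "'i set \<Rightarrow> 'i \<Rightarrow> ('i, 'k::field) seed \<Rightarrow> ('i, 'k) seed" where
  "mutate I k S =
     \<lparr>arrows = mutate_arrows k (arrows S),
      cluster = mutate_cluster I k (arrows S) (cluster S)\<rparr>"

definition torus_vertices :: "nat set" where
  "torus_vertices = {1, 2, 3}"

definition markov_quiver :: "nat \<Rightarrow> nat \<Rightarrow> int" where
  "markov_quiver i j =
     (if (i, j) \<in> {(1, 2), (2, 3), (3, 1)} then 2
      else if (i, j) \<in> {(2, 1), (3, 2), (1, 3)} then -2
      else 0)"

definition torus_seed :: "(nat, ratfun) seed" where
  "torus_seed =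
     \<lparr>arrows = markov_quiver,
      cluster = (\<lambda>i. if i = 1 then X1 else if i = 2 then X2 else if i = 3 then X3 else 0)\<rparr>"

text \<open>Direction of the \<open>i\<close>-th step, \<open>i \<ge> 1\<close>, of the mutation sequence
  \<open>\<mu>\<^sub>1, \<mu>\<^sub>2, \<mu>\<^sub>1, \<mu>\<^sub>2, \<dots>\<close>\<close>

definition direction :: "nat \<Rightarrow> nat" where
  "direction i = (if odd i then 1 else 2)"

primrec mutated_seed :: "nat \<Rightarrow> (nat, ratfun) seed" where
  "mutated_seed 0 = torus_seed"
| "mutated_seed (Suc i) = mutate torus_vertices (direction (Suc i)) (mutated_seed i)"

text \<open>The cluster variable created in the \<open>i\<close>-th step; for \<open>i = 0\<close> this is \<open>x\<^sub>2\<close>.\<close>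

definition torus_u :: "nat \<Rightarrow> ratfun" where
  "torus_u i = cluster (mutated_seed i) (direction i)"


text \<open>Edge-weighted graphs with a family of tiles, each given by its corners and its label.\<close>

record ('v, 'e, 'k) tiled_graph =
  verts :: "'v set"
  edges :: "'e set"
  ends :: "'e \<Rightarrow> 'v set"
  wt :: "'e \<Rightarrow> 'k"
  tiles :: "nat set"
  corners :: "nat \<Rightarrow> 'v set"
  tile_label :: "nat \<Rightarrow> 'k"

definition perfect_matching :: "('v, 'e, 'k) tiled_graph \<Rightarrow> 'e set \<Rightarrow> bool" where
  "perfect_matching G P \<longleftrightarrow>
     P \<subseteq> edges G \<and> (\<forall>v\<in>verts G. \<exists>!e. e \<in> P \<and> v \<in> ends G e)"

definition matching_value :: "('v, 'e, 'k::field) tiled_graph \<Rightarrow> 'k" where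
  "matching_value G =
     (\<Sum>P | perfect_matching G P. \<Prod>e\<in>P. wt G e) / (\<Prod>j\<in>tiles G. tile_label G j)"

definition full_subgraph ::
  "'v set \<Rightarrow> ('v, 'e, 'k) tiled_graph \<Rightarrow> ('v, 'e, 'k) tiled_graph" where
  "full_subgraph W G =
     G\<lparr>verts := verts G \<inter> W,
       edges := {e \<in> edges G. ends G e \<subseteq> W},
       tiles := {j \<in> tiles G. corners G j \<subseteq> W}\<rparr>"

definition remove_edge :: "'e \<Rightarrow> ('v, 'e, 'k) tiled_graph \<Rightarrow> ('v, 'e, 'k) tiled_graph" where
  "remove_edge e G = full_subgraph (- ends G e) G"

text \<open>
  The vertices of a column of square tiles are the points \<open>(c, h)\<close> with \<open>c = 0\<close> (west) or
  \<open>c = 1\<close> (east) and height \<open>h\<close>.  The \<open>j\<close>-th tile, \<open>j \<ge> 1\<close>, lies between the heights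
  \<open>j - 1\<close> and \<open>j\<close>; its vertical edges are \<open>West j\<close> and \<open>East j\<close>, its horizontal edges are
  \<open>Horizontal (j - 1)\<close> and \<open>Horizontal j\<close>.
\<close>

datatype column_edge = Horizontal nat | West nat | East nat

fun column_ends :: "column_edge \<Rightarrow> (nat \<times> nat) set" where
  "column_ends (Horizontal h) = {(0, h), (1, h)}"
| "column_ends (West j) = {(0, j - 1), (0, j)}"
| "column_ends (East j) = {(1, j - 1), (1, j)}"

fun column_wt :: "column_edge \<Rightarrow> ratfun" where
  "column_wt (Horizontal h) = X3"
| "column_wt (West j) = (if odd j then X2 else X1)"
| "column_wt (East j) = (if odd j then X2 else X1)"

definition snake :: "nat \<Rightarrow> (nat \<times> nat, column_edge, ratfun) tiled_graph" where
  "snake i =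
     \<lparr>verts = {0, 1} \<times> {0..2 * i - 1},
      edges = Horizontal ` {0..2 * i - 1} \<union> West ` {1..2 * i - 1} \<union> East ` {1..2 * i - 1},
      ends = column_ends,
      wt = column_wt,
      tiles = {1..2 * i - 1},
      corners = (\<lambda>j. {0, 1} \<times> {j - 1, j}),
      tile_label = (\<lambda>j. if odd j then X1 else X2)\<rparr>"

definition torus_v :: "nat \<Rightarrow> ratfun" where
  "torus_v i = matching_value (remove_edge (Horizontal 0) (snake i))"


text \<open>The value on the empty list is never used by the recursion.\<close>

fun cfrac :: "real list \<Rightarrow> real" where
  "cfrac [] = 0"
| "cfrac [r] = r"
| "cfrac (r # s # rs) = r + 1 / cfrac (s # rs)"

text \<open>The infinite continued fraction \<open>[r 0, r 1, r 2, \<dots>]\<close> exists and equals \<open>a\<close>.\<close>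

definition has_cfrac :: "(nat \<Rightarrow> real) \<Rightarrow> real \<Rightarrow> bool" where
  "has_cfrac r a \<longleftrightarrow> (\<lambda>n. cfrac (map r [0..<Suc n])) \<longlonglongrightarrow> a"

end

theory Submission
  imports Defs
begin

text \<open>
  Mutation only changes the sign of the Markov quiver, so the values \<open>u\<^sub>n\<close> satisfy
  \<open>u\<^sub>n\<^sub>+\<^sub>2 u\<^sub>n = u\<^sub>n\<^sub>+\<^sub>1\<^sup>2 + x\<^sub>3\<^sup>2\<close>; hence \<open>(u\<^sub>n\<^sub>+\<^sub>2 + u\<^sub>n) / u\<^sub>n\<^sub>+\<^sub>1\<close> does not depend on \<open>n\<close> and
  equals \<open>T = (x\<^sub>1\<^sup>2 + x\<^sub>2\<^sup>2 + x\<^sub>3\<^sup>2) / (x\<^sub>1 x\<^sub>2)\<close>.  Perfect matchings of a column are split according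
  to the topmost edges; two steps of the resulting recursion give \<open>v\<^sub>n\<^sub>+\<^sub>2 = T v\<^sub>n\<^sub>+\<^sub>1 - v\<^sub>n\<close>
  with \<open>v\<^sub>0 = 0\<close>.  The roots of \<open>X\<^sup>2 - T X + 1\<close> are \<open>\<beta> > 1\<close> and \<open>1 / \<beta>\<close>, and the
  limits are read off the coefficients of the dominant root.  The convergents of \<open>[z, z, \<dots>]\<close>
  are ratios of successive terms of a recurrence with roots \<open>\<alpha>\<close> and \<open>- 1 / \<alpha>\<close>.
\<close>

section \<open>Linear recurrences and continued fractions\<close>

lemma linear_recurrence_closed_form:
  fixes f :: "nat \<Rightarrow> 'a::field"
  assumes "\<And>n. f (Suc (Suc n)) = (l + m) * f (Suc n) - l * m * f n"
  shows "(l - m) * f n = (f 1 - m * f 0) * l ^ n - (f 1 - l * f 0) * m ^ n"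
proof (induction n rule: induct_nat_012)
  case (ge2 n)
  have "(l - m) * f (Suc (Suc n)) = (l + m) * ((l - m) * f (Suc n)) - l * m * ((l - m) * f n)"
    by (simp add: assms algebra_simps)
  also have "\<dots> = (f 1 - m * f 0) * l ^ Suc (Suc n) - (f 1 - l * f 0) * m ^ Suc (Suc n)"
    unfolding ge2 by (simp add: algebra_simps)
  finally show ?case .
qed (simp_all add: algebra_simps)

text \<open>After division by \<open>l ^ n\<close> the closed forms differ from constants by
  multiples of \<open>(m / l) ^ n\<close>. The limit is the quotient of the coefficients of
  \<open>l ^ n\<close>; \<open>g01\<close> makes that of \<open>g\<close> nonzero.\<close>

lemma linear_recurrence_ratio_limit:
  fixes f g :: "nat \<Rightarrow> real"
  assumes f: "\<And>n. f (Suc (Suc n)) = (l + m) * f (Suc n) - l * m * f n"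
    and g: "\<And>n. g (Suc (Suc n)) = (l + m) * g (Suc n) - l * m * g n"
    and lm: "\<bar>m\<bar> < \<bar>l\<bar>" and g01: "g 1 \<noteq> m * g 0"
  shows "(\<lambda>n. f n / g n) \<longlonglongrightarrow> (f 1 - m * f 0) / (g 1 - m * g 0)"
proof -
  define q where "q = m / l"
  have l: "l \<noteq> 0" "l \<noteq> m" using lm by auto
  have "(\<lambda>n. q ^ n) \<longlonglongrightarrow> 0"
    using lm by (intro LIMSEQ_power_zero) (simp add: q_def divide_simps)
  then have "(\<lambda>n. ((f 1 - m * f 0) - (f 1 - l * f 0) * q ^ n) /
        ((g 1 - m * g 0) - (g 1 - l * g 0) * q ^ n))
      \<longlonglongrightarrow> ((f 1 - m * f 0) - (f 1 - l * f 0) * 0) / ((g 1 - m * g 0) - (g 1 - l * g 0) * 0)"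
    using g01 by (intro tendsto_divide tendsto_diff tendsto_mult tendsto_const) auto
  moreover have "f n / g n = ((f 1 - m * f 0) - (f 1 - l * f 0) * q ^ n) /
        ((g 1 - m * g 0) - (g 1 - l * g 0) * q ^ n)" for n
  proof -
    have scale: "(l - m) * h n = l ^ n * ((h 1 - m * h 0) - (h 1 - l * h 0) * q ^ n)"
      if "\<And>n. h (Suc (Suc n)) = (l + m) * h (Suc n) - l * m * h n" for h :: "nat \<Rightarrow> real"
    proof -
      have "m ^ n = l ^ n * q ^ n" using l by (simp add: q_def power_divide)
      then show ?thesis
        using linear_recurrence_closed_form[where f = h and n = n, OF that]
        by (simp add: algebra_simps)
    qed
    \<comment> \<open>Cancelling the nonzero factors \<open>l - m\<close> and \<open>l ^ n\<close>
      stays correct where \<open>g n = 0\<close>, since both quotients are then 0; this occurs for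
      \<open>v_value\<close> at index 0.\<close>
    have "f n / g n = ((l - m) * f n) / ((l - m) * g n)" using l by simp
    then show ?thesis using l by (simp only: scale[where h = f, OF f] scale[where h = g, OF g]) simp
  qed
  ultimately show ?thesis by simp
qed

text \<open>The shifted sequence obeys the same recurrence, and the shift multiplies the coefficient
  of \<open>l ^ n\<close> by \<open>l\<close>.\<close>

lemma linear_recurrence_successive_ratio_limit:
  fixes f :: "nat \<Rightarrow> real"
  assumes f: "\<And>n. f (Suc (Suc n)) = (l + m) * f (Suc n) - l * m * f n"
    and lm: "\<bar>m\<bar> < \<bar>l\<bar>" and f01: "f 1 \<noteq> m * f 0"
  shows "(\<lambda>n. f (Suc n) / f n) \<longlonglongrightarrow> l"
proof -
  have "(\<lambda>n. f (Suc n) / f n) \<longlonglongrightarrow> (f (Suc 1) - m * f (Suc 0)) / (f 1 - m * f 0)"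
    using f f lm f01 by (rule linear_recurrence_ratio_limit)
  moreover have "f (Suc 1) - m * f (Suc 0) = l * (f 1 - m * f 0)"
    using f[of 0] by (simp add: algebra_simps)
  ultimately show ?thesis using f01 by simp
qed

text \<open>The Fibonacci polynomials at \<open>z\<close>, with the index shifted by one. Numerators
  and denominators of the convergents are both this sequence, one step apart.\<close>

fun constant_continuant :: "real \<Rightarrow> nat \<Rightarrow> real" where
  "constant_continuant z 0 = 1"
| "constant_continuant z (Suc 0) = z"
| "constant_continuant z (Suc (Suc n)) = z * constant_continuant z (Suc n) + constant_continuant z n"

lemma constant_continuant_pos: "z > 0 \<Longrightarrow> constant_continuant z n > 0"
  by (induction n rule: induct_nat_012) (simp_all add: add_pos_pos)

lemma cfrac_constant:
  assumes "z > 0"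
  shows "cfrac (map (\<lambda>_. z) [0..<Suc n]) = constant_continuant z (Suc n) / constant_continuant z n"
proof -
  have "cfrac (replicate (Suc n) z) = constant_continuant z (Suc n) / constant_continuant z n"
  proof (induction n)
    case (Suc n)
    have "cfrac (replicate (Suc (Suc n)) z) = z + 1 / cfrac (replicate (Suc n) z)" by simp
    then show ?case
      using constant_continuant_pos[OF assms, of n] constant_continuant_pos[OF assms, of "Suc n"]
      unfolding Suc by (simp add: field_simps)
  qed simp
  then show ?thesis by (simp only: map_replicate_const length_upt diff_zero)
qed

text \<open>By \<open>root\<close>, the polynomial \<open>X^2 - z X - 1\<close> has the roots
  \<open>a\<close> and \<open>- 1 / a\<close>, and \<open>a * a > 1\<close> makes \<open>a\<close>
  dominant.\<close>

lemma has_cfrac_constant: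
  fixes z a :: real
  assumes "z > 0" and "a > 0" and root: "a\<^sup>2 = z * a + 1"
  shows "has_cfrac (\<lambda>_. z) a"
proof -
  have z: "z = a + (- 1 / a)"
    using assms by (simp add: field_simps power2_eq_square)
  have am: "a * (- 1 / a) = - 1" using \<open>a > 0\<close> by simp
  have "1 < a * a"
    using assms by (simp add: power2_eq_square)
  then have "\<bar>- 1 / a\<bar> < \<bar>a\<bar>"
    using \<open>a > 0\<close> by (simp add: divide_simps)
  moreover have "constant_continuant z (Suc (Suc n)) =
      (a + (- 1 / a)) * constant_continuant z (Suc n) - a * (- 1 / a) * constant_continuant z n" for n
    by (simp only: z[symmetric] am constant_continuant.simps)
  \<comment> \<open>The continuants start with 1 and \<open>z\<close>, so the coefficient of
    \<open>a ^ n\<close> could vanish only for \<open>z = - 1 / a\<close>, which the signs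
    exclude.\<close>
  moreover have "- 1 / a < 0" using \<open>a > 0\<close> by simp
  then have "- 1 / a < z" using \<open>z > 0\<close> by (rule less_trans)
  then have "constant_continuant z 1 \<noteq> (- 1 / a) * constant_continuant z 0"
    by auto
  ultimately have "(\<lambda>n. constant_continuant z (Suc n) / constant_continuant z n) \<longlonglongrightarrow> a"
    by (intro linear_recurrence_successive_ratio_limit)
  then show ?thesis
    by (simp only: has_cfrac_def cfrac_constant[OF \<open>z > 0\<close>])
qed

text \<open>A leading 0 inverts what follows, so the truncations are, one index later, the
  reciprocals of those of \<open>[z, z, ...]\<close>.\<close>

lemma has_cfrac_0_constant:
  fixes z a :: real
  assumes "has_cfrac (\<lambda>_. z) a" and "a \<noteq> 0"
  shows "has_cfrac (\<lambda>n. if n = 0 then 0 else z) (1 / a)"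
proof -
  let ?c = "\<lambda>n. cfrac (map (\<lambda>k. if k = 0 then 0 else z) [0..<Suc n])"
  have "?c (Suc n) = 1 / cfrac (map (\<lambda>_. z) [0..<Suc n])" for n
  proof -
    have "map (\<lambda>k. if k = 0 then 0 else z) [0..<Suc (Suc n)] = 0 # z # replicate n z"
      by (rule nth_equalityI) (auto simp: nth_Cons simp del: upt_Suc split: nat.split)
    moreover have "map (\<lambda>_. z) [0..<Suc n] = z # replicate n z"
      by (simp add: map_replicate_const del: upt_Suc)
    ultimately show ?thesis by (simp del: upt_Suc)
  qed
  moreover have "(\<lambda>n. 1 / cfrac (map (\<lambda>_. z) [0..<Suc n])) \<longlonglongrightarrow> 1 / a"
    using assms unfolding has_cfrac_def by (intro tendsto_divide tendsto_const)
  ultimately have "(\<lambda>n. ?c (Suc n)) \<longlonglongrightarrow> 1 / a" by presburger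
  then show ?thesis
    unfolding has_cfrac_def by (rule LIMSEQ_imp_Suc)
qed

section \<open>Evaluation of rational functions\<close>

text \<open>The induction step for nested polynomials: three applications, starting from
  \<open>real_of_int\<close>, make \<open>pol_eval\<close> a ring homomorphism.\<close>

lemma poly_map_poly_hom:
  fixes h :: "'a::comm_ring_1 \<Rightarrow> 'b::comm_ring_1"
  assumes "h 0 = 0" "h 1 = 1" "\<And>x y. h (x + y) = h x + h y" "\<And>x y. h (x * y) = h x * h y"
  defines "e \<equiv> \<lambda>c p. poly (map_poly h p) c"
  shows "e c 0 = 0" "e c 1 = 1" "e c (p + q) = e c p + e c q" "e c (p * q) = e c p * e c q"
proof -
  have pCons: "e c (pCons a p) = h a + c * e c p" for a p
    by (simp add: e_def map_poly_pCons assms(1))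
  have zero: "e c 0 = 0" by (simp add: e_def)
  then show "e c 0 = 0" .
  show "e c 1 = 1" by (simp add: e_def map_poly_1' assms)
  have add: "e c (p + q) = e c p + e c q" for p q
    by (induction p q rule: poly_induct2) (simp_all add: pCons assms(1-4) zero algebra_simps)
  show "e c (p + q) = e c p + e c q" by (rule add)
  have smult: "e c (smult a q) = h a * e c q" for a q
    by (induction q) (simp_all add: pCons assms(1-4) zero algebra_simps)
  show "e c (p * q) = e c p * e c q"
    by (induction p) (simp_all add: zero pCons add smult assms(1-4) algebra_simps)
qed

lemma pol_eval_hom:
  "pol_eval a b c 0 = 0" "pol_eval a b c 1 = 1"
  "pol_eval a b c (p + q) = pol_eval a b c p + pol_eval a b c q"
  "pol_eval a b c (p * q) = pol_eval a b c p * pol_eval a b c q"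
proof -
  define e1 where "e1 r = poly (map_poly real_of_int r) a" for r
  define e2 where "e2 q = poly (map_poly e1 q) b" for q
  have e1: "e1 0 = 0" "e1 1 = 1" "e1 (x + y) = e1 x + e1 y" "e1 (x * y) = e1 x * e1 y" for x y
    unfolding e1_def by (rule poly_map_poly_hom; simp)+
  have e2: "e2 0 = 0" "e2 1 = 1" "e2 (x + y) = e2 x + e2 y" "e2 (x * y) = e2 x * e2 y" for x y
    unfolding e2_def by (rule poly_map_poly_hom; simp add: e1)+
  have pol_eval: "pol_eval a b c p = poly (map_poly e2 p) c" for p
    by (simp add: pol_eval_def e1_def[abs_def] e2_def[abs_def])
  show "pol_eval a b c 0 = 0" "pol_eval a b c 1 = 1"
    "pol_eval a b c (p + q) = pol_eval a b c p + pol_eval a b c q"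
    "pol_eval a b c (p * q) = pol_eval a b c p * pol_eval a b c q"
    unfolding pol_eval by (rule poly_map_poly_hom; simp add: e2)+
qed

text \<open>Relational form of \<open>rat_eval\<close>: regularity and value travel together through
  the field operations, and the description operator is resolved only once, in
  \<open>rat_eval_eqI\<close>.\<close>

definition has_value :: "real \<Rightarrow> real \<Rightarrow> real \<Rightarrow> ratfun \<Rightarrow> real \<Rightarrow> bool" where
  "has_value a b c f r \<longleftrightarrow> (\<exists>p q. f = Fract p q \<and> pol_eval a b c q \<noteq> 0 \<and>
                   r = pol_eval a b c p / pol_eval a b c q)"

text \<open>Evaluation respects the cross-multiplied identity of two equal fractions. A denominator
  that does not vanish at the point is a nonzero polynomial, as \<open>eq_fract\<close>
  requires.\<close>

lemma has_value_unique:
  assumes "has_value a b c f r" "has_value a b c f s"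
  shows "r = s"
proof -
  obtain p q p' q' where *: "f = Fract p q" "pol_eval a b c q \<noteq> 0"
      "r = pol_eval a b c p / pol_eval a b c q"
      "f = Fract p' q'" "pol_eval a b c q' \<noteq> 0" "s = pol_eval a b c p' / pol_eval a b c q'"
    using assms unfolding has_value_def by blast
  then have "q \<noteq> 0" "q' \<noteq> 0" by (auto simp: pol_eval_hom)
  then have "p * q' = p' * q" using * by (simp add: eq_fract)
  then have "pol_eval a b c p * pol_eval a b c q' = pol_eval a b c p' * pol_eval a b c q"
    by (metis pol_eval_hom(4))
  then show ?thesis unfolding *(3,6) using *(2,5) by (simp add: field_simps)
qed

lemma rat_eval_eqI:
  assumes "has_value a b c f r"
  shows "rat_eval a b c f = r"
  unfolding rat_eval_def has_value_def[symmetric]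
  using assms has_value_unique by blast

lemma has_value_add:
  assumes "has_value a b c f r" "has_value a b c g s"
  shows "has_value a b c (f + g) (r + s)"
proof -
  obtain p q p' q' where *: "f = Fract p q" "pol_eval a b c q \<noteq> 0"
      "r = pol_eval a b c p / pol_eval a b c q"
      "g = Fract p' q'" "pol_eval a b c q' \<noteq> 0" "s = pol_eval a b c p' / pol_eval a b c q'"
    using assms unfolding has_value_def by blast
  then have "q \<noteq> 0" "q' \<noteq> 0" by (auto simp: pol_eval_hom)
  then have "f + g = Fract (p * q' + p' * q) (q * q')" using * by simp
  moreover have "r + s = pol_eval a b c (p * q' + p' * q) / pol_eval a b c (q * q')"
    "pol_eval a b c (q * q') \<noteq> 0"
    unfolding *(3,6) using *(2,5) by (simp_all add: pol_eval_hom field_simps)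
  ultimately show ?thesis unfolding has_value_def by blast
qed

lemma has_value_mult:
  assumes "has_value a b c f r" "has_value a b c g s"
  shows "has_value a b c (f * g) (r * s)"
proof -
  obtain p q p' q' where *: "f = Fract p q" "pol_eval a b c q \<noteq> 0"
      "r = pol_eval a b c p / pol_eval a b c q"
      "g = Fract p' q'" "pol_eval a b c q' \<noteq> 0" "s = pol_eval a b c p' / pol_eval a b c q'"
    using assms unfolding has_value_def by blast
  then have "f * g = Fract (p * p') (q * q')" by simp
  moreover have "r * s = pol_eval a b c (p * p') / pol_eval a b c (q * q')"
    "pol_eval a b c (q * q') \<noteq> 0"
    using * by (simp_all add: pol_eval_hom)
  ultimately show ?thesis unfolding has_value_def by blast
qed

lemma has_value_inverse:
  assumes "has_value a b c f r" "r \<noteq> 0"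
  shows "has_value a b c (inverse f) (inverse r)"
proof -
  obtain p q where "f = Fract p q" "pol_eval a b c q \<noteq> 0"
      "r = pol_eval a b c p / pol_eval a b c q"
    using assms unfolding has_value_def by blast
  then have "inverse f = Fract q p \<and> pol_eval a b c p \<noteq> 0 \<and>
      inverse r = pol_eval a b c q / pol_eval a b c p"
    using assms(2) by auto
  then show ?thesis unfolding has_value_def by blast
qed

lemma has_value_divide:
  assumes "has_value a b c f r" "has_value a b c g s" "s \<noteq> 0"
  shows "has_value a b c (f / g) (r / s)"
  using has_value_mult[OF assms(1) has_value_inverse[OF assms(2,3)]]
  by (simp add: divide_inverse)

lemma has_value_1: "has_value a b c 1 1"
  unfolding has_value_def One_fract_def
  by (intro exI[of _ 1]) (simp add: pol_eval_hom)

lemma has_value_power: "has_value a b c f r \<Longrightarrow> has_value a b c (f ^ n) (r ^ n)"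
  by (induction n) (simp_all add: has_value_1 has_value_mult)

lemma has_value_variables:
  "has_value a b c X1 a" "has_value a b c X2 b" "has_value a b c X3 c"
proof -
  have *: "has_value a b c (Fract p 1) (pol_eval a b c p)" for p
    unfolding has_value_def by (intro exI[of _ p] exI[of _ 1]) (simp add: pol_eval_hom)
  have "pol_eval a b c [:[:[:0, 1:]:]:] = a" "pol_eval a b c [:[:0, 1:]:] = b"
    "pol_eval a b c [:0, 1:] = c"
    by (simp_all add: pol_eval_def map_poly_pCons map_poly_1' one_pCons)
  then show "has_value a b c X1 a" "has_value a b c X2 b" "has_value a b c X3 c"
    using *[of "[:[:[:0, 1:]:]:]"] *[of "[:[:0, 1:]:]"] *[of "[:0, 1:]"]
    by (simp_all add: X1_def X2_def X3_def)
qed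

lemmas has_value_intros =
  has_value_variables has_value_1 has_value_add has_value_mult has_value_divide has_value_power

section \<open>Perfect matchings of ladders\<close>

text \<open>What remains of a column after height 0 is deleted. Verticals start at 2 because
  \<open>West j\<close> and \<open>East j\<close> reach down to height \<open>j - 1\<close>.\<close>

definition ladder_edges :: "nat \<Rightarrow> column_edge set" where
  "ladder_edges n = Horizontal ` {1..n} \<union> West ` {2..n} \<union> East ` {2..n}"

definition ladder_matchings :: "nat \<Rightarrow> column_edge set set" where
  "ladder_matchings n = {P. P \<subseteq> ladder_edges n \<and>
     (\<forall>v\<in>{0, 1} \<times> {1..n}. \<exists>!e. e \<in> P \<and> v \<in> column_ends e)}"

text \<open>Propositional form of unique coverage at a vertex with three candidate edges, so that
  local changes of a matching can be checked by case analysis.\<close>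

definition exactly_one :: "bool \<Rightarrow> bool \<Rightarrow> bool \<Rightarrow> bool" where
  "exactly_one p q r \<longleftrightarrow> p \<and> \<not> q \<and> \<not> r \<or> \<not> p \<and> q \<and> \<not> r \<or> \<not> p \<and> \<not> q \<and> r"

lemma ladder_edges_mem [simp]:
  "Horizontal h \<in> ladder_edges n \<longleftrightarrow> 1 \<le> h \<and> h \<le> n"
  "West h \<in> ladder_edges n \<longleftrightarrow> 2 \<le> h \<and> h \<le> n"
  "East h \<in> ladder_edges n \<longleftrightarrow> 2 \<le> h \<and> h \<le> n"
  by (auto simp: ladder_edges_def)

lemma column_ends_mem:
  assumes "1 \<le> h"
  shows "(0, h) \<in> column_ends e \<longleftrightarrow> e = Horizontal h \<or> e = West h \<or> e = West (Suc h)"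
    "(1, h) \<in> column_ends e \<longleftrightarrow> e = Horizontal h \<or> e = East h \<or> e = East (Suc h)"
  using assms by (cases e; auto)+

text \<open>A vertex can meet only its rung and the verticals below and above. At the bottom and the
  top a missing vertical is already excluded by \<open>P \<subseteq> ladder_edges n\<close>, so all
  heights are treated alike.\<close>

lemma mem_ladder_matchings:
  "P \<in> ladder_matchings n \<longleftrightarrow> P \<subseteq> ladder_edges n \<and>
     (\<forall>h. 1 \<le> h \<and> h \<le> n \<longrightarrow>
        exactly_one (Horizontal h \<in> P) (West h \<in> P) (West (Suc h) \<in> P) \<and>
        exactly_one (Horizontal h \<in> P) (East h \<in> P) (East (Suc h) \<in> P))"
proof -
  have *: "(\<exists>!e. e \<in> P \<and> (e = a \<or> e = b \<or> e = c)) \<longleftrightarrow> exactly_one (a \<in> P) (b \<in> P) (c \<in> P)"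
    if "a \<noteq> b" "a \<noteq> c" "b \<noteq> c" for a b c :: column_edge
    unfolding exactly_one_def using that
    by (cases "a \<in> P"; cases "b \<in> P"; cases "c \<in> P"; simp; blast)
  have "(\<exists>!e. e \<in> P \<and> (0, h) \<in> column_ends e) \<longleftrightarrow>
        exactly_one (Horizontal h \<in> P) (West h \<in> P) (West (Suc h) \<in> P)"
    "(\<exists>!e. e \<in> P \<and> (1, h) \<in> column_ends e) \<longleftrightarrow>
        exactly_one (Horizontal h \<in> P) (East h \<in> P) (East (Suc h) \<in> P)"
    if "1 \<le> h" for h
    unfolding column_ends_mem[OF that] by (simp_all add: *)
  then show ?thesis
    unfolding ladder_matchings_def by auto
qed

lemma ladder_edges_Suc_subset: "ladder_edges n \<subseteq> ladder_edges (Suc n)"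
  by (auto simp: ladder_edges_def)

lemma ladder_matchings_insert_horizontal:
  assumes "P \<in> ladder_matchings (Suc n)"
  shows "insert (Horizontal (Suc (Suc n))) P \<in> ladder_matchings (Suc (Suc n))"
proof -
  have P: "P \<subseteq> ladder_edges (Suc n)" using assms by (simp add: mem_ladder_matchings)
  then have "West (Suc (Suc n)) \<notin> P" "West (Suc (Suc (Suc n))) \<notin> P"
    "East (Suc (Suc n)) \<notin> P" "East (Suc (Suc (Suc n))) \<notin> P"
    by auto
  then show ?thesis
    using assms ladder_edges_Suc_subset[of "Suc n"]
    by (auto simp: mem_ladder_matchings le_Suc_eq[of _ "Suc n"] exactly_one_def)
qed

lemma ladder_matchings_insert_verticals:
  assumes "P \<in> ladder_matchings n"
  shows "insert (West (Suc (Suc n))) (insert (East (Suc (Suc n))) P) \<in> ladder_matchings (Suc (Suc n))"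
proof -
  have P: "P \<subseteq> ladder_edges n" using assms by (simp add: mem_ladder_matchings)
  then have "Horizontal (Suc n) \<notin> P" "Horizontal (Suc (Suc n)) \<notin> P"
    "West (Suc n) \<notin> P" "East (Suc n) \<notin> P"
    "West (Suc (Suc n)) \<notin> P" "West (Suc (Suc (Suc n))) \<notin> P"
    "East (Suc (Suc n)) \<notin> P" "East (Suc (Suc (Suc n))) \<notin> P"
    by auto
  then show ?thesis
    using assms ladder_edges_Suc_subset[of "Suc n"] ladder_edges_Suc_subset[of n]
    by (auto simp: mem_ladder_matchings le_Suc_eq[of _ "Suc n"] le_Suc_eq[of _ n] exactly_one_def)
qed

lemma ladder_matchings_remove_horizontal:
  assumes P: "P \<in> ladder_matchings (Suc (Suc n))" and H: "Horizontal (Suc (Suc n)) \<in> P"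
  shows "P - {Horizontal (Suc (Suc n))} \<in> ladder_matchings (Suc n)"
proof -
  have sub: "P \<subseteq> ladder_edges (Suc (Suc n))"
    and one: "\<And>h. 1 \<le> h \<Longrightarrow> h \<le> Suc (Suc n) \<Longrightarrow>
        exactly_one (Horizontal h \<in> P) (West h \<in> P) (West (Suc h) \<in> P) \<and>
        exactly_one (Horizontal h \<in> P) (East h \<in> P) (East (Suc h) \<in> P)"
    using P by (auto simp: mem_ladder_matchings)
  have no: "West (Suc (Suc n)) \<notin> P" "East (Suc (Suc n)) \<notin> P"
    using one[of "Suc (Suc n)"] H by (auto simp: exactly_one_def)
  have "e \<in> ladder_edges (Suc n)" if "e \<in> P - {Horizontal (Suc (Suc n))}" for e
    using that sub no by (cases e) (fastforce simp: le_Suc_eq)+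
  then show ?thesis
    using one by (auto simp: mem_ladder_matchings)
qed

text \<open>Without the top rung each top vertex must be covered by its vertical. The two verticals
  also occupy both vertices at height \<open>Suc n\<close>, so the other edges stay at heights up to
  \<open>n\<close>.\<close>

lemma ladder_matchings_remove_verticals:
  assumes P: "P \<in> ladder_matchings (Suc (Suc n))" and H: "Horizontal (Suc (Suc n)) \<notin> P"
  shows "West (Suc (Suc n)) \<in> P" "East (Suc (Suc n)) \<in> P"
    "P - {West (Suc (Suc n)), East (Suc (Suc n))} \<in> ladder_matchings n"
proof -
  have sub: "P \<subseteq> ladder_edges (Suc (Suc n))"
    and one: "\<And>h. 1 \<le> h \<Longrightarrow> h \<le> Suc (Suc n) \<Longrightarrow>
        exactly_one (Horizontal h \<in> P) (West h \<in> P) (West (Suc h) \<in> P) \<and>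
        exactly_one (Horizontal h \<in> P) (East h \<in> P) (East (Suc h) \<in> P)"
    using P by (auto simp: mem_ladder_matchings)
  have "West (Suc (Suc (Suc n))) \<notin> P" "East (Suc (Suc (Suc n))) \<notin> P"
    using sub by auto
  then show yes: "West (Suc (Suc n)) \<in> P" "East (Suc (Suc n)) \<in> P"
    using one[of "Suc (Suc n)"] H by (auto simp: exactly_one_def)
  have no: "Horizontal (Suc n) \<notin> P" "West (Suc n) \<notin> P" "East (Suc n) \<notin> P"
    using one[of "Suc n"] yes by (auto simp: exactly_one_def)
  have "e \<in> ladder_edges n" if "e \<in> P - {West (Suc (Suc n)), East (Suc (Suc n))}" for e
    using that sub no H by (cases e) (fastforce simp: le_Suc_eq)+
  then show "P - {West (Suc (Suc n)), East (Suc (Suc n))} \<in> ladder_matchings n"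
    using one by (auto simp: mem_ladder_matchings)
qed

lemma ladder_matchings_Suc_Suc:
  "ladder_matchings (Suc (Suc n)) =
     insert (Horizontal (Suc (Suc n))) ` ladder_matchings (Suc n) \<union>
     (\<lambda>P. insert (West (Suc (Suc n))) (insert (East (Suc (Suc n))) P)) ` ladder_matchings n"
  (is "?M = ?A \<union> ?B")
proof
  show "?A \<union> ?B \<subseteq> ?M"
    using ladder_matchings_insert_horizontal ladder_matchings_insert_verticals by blast
  show "?M \<subseteq> ?A \<union> ?B"
  proof
    fix P assume P: "P \<in> ?M"
    show "P \<in> ?A \<union> ?B"
    proof (cases "Horizontal (Suc (Suc n)) \<in> P")
      case True
      then have "P = insert (Horizontal (Suc (Suc n))) (P - {Horizontal (Suc (Suc n))})" by blast
      then show ?thesis using ladder_matchings_remove_horizontal[OF P True] by blast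
    next
      case False
      note remove = ladder_matchings_remove_verticals[OF P False]
      then have "P = insert (West (Suc (Suc n))) (insert (East (Suc (Suc n)))
          (P - {West (Suc (Suc n)), East (Suc (Suc n))}))" by blast
      then show ?thesis using remove(3) by blast
    qed
  qed
qed

definition ladder_sum :: "nat \<Rightarrow> ratfun" where
  "ladder_sum n = (\<Sum>P\<in>ladder_matchings n. \<Prod>e\<in>P. column_wt e)"

lemma ladder_sum_0: "ladder_sum 0 = 1"
proof -
  have "ladder_matchings 0 = {{}}"
    by (auto simp: ladder_matchings_def ladder_edges_def)
  then show ?thesis by (simp add: ladder_sum_def)
qed

lemma ladder_sum_1: "ladder_sum (Suc 0) = X3"
proof -
  have edges: "ladder_edges (Suc 0) = {Horizontal 1}"
    by (auto simp: ladder_edges_def)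
  have height: "1 \<le> h \<and> h \<le> Suc 0 \<longleftrightarrow> h = 1" for h by auto
  have "P \<in> ladder_matchings (Suc 0) \<longleftrightarrow> P = {Horizontal 1}" for P
    unfolding mem_ladder_matchings edges height subset_singleton_iff exactly_one_def by auto
  then have "ladder_matchings (Suc 0) = {{Horizontal 1}}" by blast
  then show ?thesis by (simp add: ladder_sum_def)
qed

text \<open>The rung contributes \<open>X3\<close>. The two verticals of a tile have equal weights,
  hence the square, and \<open>Suc (Suc n)\<close> has the parity of \<open>n\<close>.\<close>

lemma ladder_sum_Suc_Suc:
  "ladder_sum (Suc (Suc n)) =
     X3 * ladder_sum (Suc n) + (if odd n then X2 else X1)\<^sup>2 * ladder_sum n"
proof -
  let ?H = "Horizontal (Suc (Suc n))" and ?W = "West (Suc (Suc n))" and ?E = "East (Suc (Suc n))"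
  have finE: "finite (ladder_edges k)" for k by (simp add: ladder_edges_def)
  have sub: "P \<subseteq> ladder_edges k" if "P \<in> ladder_matchings k" for P k
    using that by (simp add: mem_ladder_matchings)
  have fin: "finite (ladder_matchings k)" for k
    using finE[of k] sub by (meson finite_Pow_iff finite_subset PowI subsetI)
  have H: "?H \<notin> P" if "P \<in> ladder_matchings (Suc n)" for P using sub[OF that] by auto
  have V: "?H \<notin> P" "?W \<notin> P" "?E \<notin> P" if "P \<in> ladder_matchings n" for P
    using sub[OF that] by auto
  have finP: "finite P" if "P \<in> ladder_matchings k" for P k
    using finite_subset[OF sub[OF that] finE] .
  have "inj_on (insert ?H) (ladder_matchings (Suc n))"
    by (rule inj_onI) (metis H insert_ident)
  then have 1: "(\<Sum>P\<in>insert ?H ` ladder_matchings (Suc n). \<Prod>e\<in>P. column_wt e) = X3 * ladder_sum (Suc n)"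
    by (simp add: sum.reindex ladder_sum_def sum_distrib_left H finP)
  have "inj_on (\<lambda>P. insert ?W (insert ?E P)) (ladder_matchings n)"
    by (rule inj_onI) (metis V(2,3) insert_ident insert_iff column_edge.distinct(5))
  then have 2: "(\<Sum>P\<in>(\<lambda>P. insert ?W (insert ?E P)) ` ladder_matchings n. \<Prod>e\<in>P. column_wt e)
      = (if odd n then X2 else X1)\<^sup>2 * ladder_sum n"
    by (simp add: sum.reindex ladder_sum_def sum_distrib_left V finP power2_eq_square mult.assoc)
  have disj: "insert ?H ` ladder_matchings (Suc n) \<inter>
      (\<lambda>P. insert ?W (insert ?E P)) ` ladder_matchings n = {}"
    using V(1) by fastforce
  show ?thesis
    unfolding 1[symmetric] 2[symmetric]
    unfolding ladder_sum_def[of "Suc (Suc n)"] ladder_matchings_Suc_Suc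
    by (rule sum.union_disjoint) (use fin disj in auto)
qed

text \<open>Deleting the ends of the bottom edge destroys tile 1. Tiles 2 to
  \<open>2 * i + 1\<close> remain, \<open>i\<close> of each label.\<close>

lemma torus_v_Suc: "torus_v (Suc i) = ladder_sum (Suc (2 * i)) / (X1 * X2) ^ i"
proof -
  let ?G = "remove_edge (Horizontal 0) (snake (Suc i))"
  have verts: "verts ?G = {0, 1} \<times> {1..Suc (2 * i)}"
    by (auto simp: remove_edge_def full_subgraph_def snake_def)
  have edges: "edges ?G = ladder_edges (Suc (2 * i))"
  proof (rule set_eqI)
    fix e show "e \<in> edges ?G \<longleftrightarrow> e \<in> ladder_edges (Suc (2 * i))"
      by (cases e) (auto simp: remove_edge_def full_subgraph_def snake_def)
  qed
  have tiles: "tiles ?G = {2..Suc (2 * i)}"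
    by (auto simp: remove_edge_def full_subgraph_def snake_def)
  have "ends ?G = column_ends" and wt: "wt ?G = column_wt"
    and label: "tile_label ?G = (\<lambda>j. if odd j then X1 else X2)"
    by (simp_all add: remove_edge_def full_subgraph_def snake_def)
  then have "{P. perfect_matching ?G P} = ladder_matchings (Suc (2 * i))"
    by (simp add: perfect_matching_def ladder_matchings_def verts edges)
  moreover have "(\<Prod>j\<in>{2..Suc (2 * i)}. if odd j then X1 else X2) = (X1 * X2) ^ i"
  proof (induction i)
    case (Suc i)
    have "{2..Suc (2 * Suc i)} = insert (Suc (2 * Suc i)) (insert (2 * Suc i) {2..Suc (2 * i)})"
      by auto
    then show ?case using Suc by (simp add: mult_ac)
  qed simp
  ultimately show ?thesis
    by (simp add: torus_v_def matching_value_def ladder_sum_def tiles label wt)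
qed

section \<open>Mutations of the torus seed\<close>

text \<open>The paths through the mutated vertex give 2 * 2 = 4 arrows against the 2 arrows between
  the other two vertices; cancellation leaves 2 reversed arrows.\<close>

lemma arrows_mutated_seed: "arrows (mutated_seed n) i j = (- 1) ^ n * markov_quiver i j"
proof (induction n arbitrary: i j)
  case (Suc n)
  have "arrows (mutated_seed n) = (\<lambda>i j. (- 1) ^ n * markov_quiver i j)"
    using Suc by blast
  then show ?case
    by (cases "even n")
      (auto simp: mutate_def mutate_arrows_def direction_def markov_quiver_def)
qed (simp add: torus_seed_def)

text \<open>Up to sign the quiver never changes, so both exchange monomials are squares. Besides 3,
  the neighbour of the mutated vertex is \<open>direction n\<close>, which is 2 for
  \<open>n = 0\<close>.\<close>

lemma cluster_mutated_seed_Suc: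
  "cluster (mutated_seed (Suc n)) =
     (cluster (mutated_seed n))(direction (Suc n) :=
       ((cluster (mutated_seed n) (direction n))\<^sup>2 + (cluster (mutated_seed n) 3)\<^sup>2) /
         cluster (mutated_seed n) (direction (Suc n)))"
  by (cases "even n")
    (simp_all add: mutate_def mutate_cluster_def arrows_mutated_seed torus_vertices_def
      direction_def markov_quiver_def add.commute)

lemma cluster_mutated_seed_3: "cluster (mutated_seed n) 3 = X3"
  by (induction n)
    (simp_all add: cluster_mutated_seed_Suc direction_def torus_seed_def del: mutated_seed.simps(2))

lemma torus_u_0: "torus_u 0 = X2"
  by (simp add: torus_u_def direction_def torus_seed_def)

lemma torus_u_1: "torus_u (Suc 0) = (X2\<^sup>2 + X3\<^sup>2) / X1"
  unfolding torus_u_def cluster_mutated_seed_Suc cluster_mutated_seed_3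
  by (simp add: direction_def torus_seed_def)

lemma torus_u_Suc_Suc: "torus_u (Suc (Suc n)) = ((torus_u (Suc n))\<^sup>2 + X3\<^sup>2) / torus_u n"
proof -
  \<comment> \<open>Directions have period two, and step \<open>Suc n\<close> changes only the other
    vertex.\<close>
  have "cluster (mutated_seed (Suc n)) (direction (Suc (Suc n))) = torus_u n"
    unfolding torus_u_def cluster_mutated_seed_Suc by (simp add: direction_def)
  then show ?thesis
    unfolding torus_u_def[of "Suc (Suc n)"] cluster_mutated_seed_Suc[of "Suc n"]
      cluster_mutated_seed_3
    by (simp add: torus_u_def)
qed

section \<open>The values of the cluster variables\<close>

fun u_value :: "real \<Rightarrow> real \<Rightarrow> real \<Rightarrow> nat \<Rightarrow> real" where
  "u_value a b c 0 = b"
| "u_value a b c (Suc 0) = (b\<^sup>2 + c\<^sup>2) / a"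
| "u_value a b c (Suc (Suc n)) = ((u_value a b c (Suc n))\<^sup>2 + c\<^sup>2) / u_value a b c n"

fun ladder_value :: "real \<Rightarrow> real \<Rightarrow> real \<Rightarrow> nat \<Rightarrow> real" where
  "ladder_value a b c 0 = 1"
| "ladder_value a b c (Suc 0) = c"
| "ladder_value a b c (Suc (Suc n)) =
     c * ladder_value a b c (Suc n) + (if odd n then b else a)\<^sup>2 * ladder_value a b c n"

text \<open>At \<open>0\<close> this is the backward continuation of the recurrence, not the value of \<open>torus_v 0\<close>.\<close>

fun v_value :: "real \<Rightarrow> real \<Rightarrow> real \<Rightarrow> nat \<Rightarrow> real" where
  "v_value a b c 0 = 0"
| "v_value a b c (Suc n) = ladder_value a b c (Suc (2 * n)) / (a * b) ^ n"

context
  fixes a b c :: real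
  assumes pos: "a > 0" "b > 0" "c > 0"
begin

lemma u_value_pos: "u_value a b c n > 0"
  by (induction n rule: induct_nat_012) (use pos in \<open>simp_all add: add_pos_pos\<close>)

lemma has_value_torus_u: "has_value a b c (torus_u n) (u_value a b c n)"
proof (induction n rule: induct_nat_012)
  case (ge2 n)
  then show ?case
    using u_value_pos[of n]
    unfolding torus_u_Suc_Suc u_value.simps by (intro has_value_intros) auto
qed (use pos in \<open>auto simp: torus_u_0 torus_u_1 intro!: has_value_intros\<close>)

lemma has_value_ladder_sum: "has_value a b c (ladder_sum n) (ladder_value a b c n)"
proof (induction n rule: induct_nat_012)
  case (ge2 n)
  then show ?case
    unfolding ladder_sum_Suc_Suc ladder_value.simps
    by (intro has_value_intros) (simp_all add: has_value_variables)
qed (simp_all add: ladder_sum_0 ladder_sum_1 has_value_intros)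

lemma has_value_torus_v: "has_value a b c (torus_v (Suc n)) (v_value a b c (Suc n))"
  using pos unfolding torus_v_Suc v_value.simps
  by (intro has_value_intros has_value_ladder_sum) simp

lemma u_value_recurrence:
  "u_value a b c (Suc (Suc n)) =
     (a\<^sup>2 + b\<^sup>2 + c\<^sup>2) / (a * b) * u_value a b c (Suc n) - u_value a b c n"
proof (induction n)
  case 0
  then show ?case using pos by (simp add: field_simps power2_eq_square)
next
  case (Suc n)
  define p q r s where defs: "p = u_value a b c n" "q = u_value a b c (Suc n)"
    "r = u_value a b c (Suc (Suc n))" "s = u_value a b c (Suc (Suc (Suc n)))"
  define T where "T = (a\<^sup>2 + b\<^sup>2 + c\<^sup>2) / (a * b)"
  have nz: "p > 0" "q > 0" "r > 0" by (simp_all only: defs u_value_pos)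
  have r: "r * p = q\<^sup>2 + c\<^sup>2" and s: "s * q = r\<^sup>2 + c\<^sup>2"
    using nz unfolding defs u_value.simps(3) by simp_all
  have IH: "r = T * q - p" using Suc by (simp only: defs T_def)
  \<comment> \<open>Eliminating \<open>c\<^sup>2\<close> from the two exchange relations gives
    \<open>(s + q) / r = (r + p) / q\<close>; the induction hypothesis evaluates the right side to
    \<open>T\<close>.\<close>
  have "q * (s + q) = q * (T * r)"
  proof -
    have "q * (s + q) = r\<^sup>2 + (q\<^sup>2 + c\<^sup>2)" using s by (simp add: algebra_simps power2_eq_square)
    also have "\<dots> = r * (r + p)" unfolding r[symmetric] by (simp add: algebra_simps power2_eq_square)
    also have "\<dots> = q * (T * r)" by (simp add: IH)
    finally show ?thesis .
  qed
  then have "s = T * r - q" using nz by simp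
  then show ?case by (simp only: defs T_def)
qed

lemma v_value_recurrence:
  "v_value a b c (Suc (Suc n)) =
     (a\<^sup>2 + b\<^sup>2 + c\<^sup>2) / (a * b) * v_value a b c (Suc n) - v_value a b c n"
proof (cases n)
  case 0
  then show ?thesis using pos by (simp add: numeral_eq_Suc field_simps)
next
  case (Suc k)
  let ?L = "ladder_value a b c"
  \<comment> \<open>Terms of even index are eliminated. The two squared weights multiply to
    \<open>(a * b)\<^sup>2\<close>, which the normalising powers of \<open>a * b\<close>
    absorb.\<close>
  have "?L (Suc (2 * Suc (Suc k))) =
      (a\<^sup>2 + b\<^sup>2 + c\<^sup>2) * ?L (Suc (2 * Suc k)) - (a * b)\<^sup>2 * ?L (Suc (2 * k))"
    by (simp add: algebra_simps power2_eq_square)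
  then have "v_value a b c (Suc (Suc (Suc k))) =
      ((a\<^sup>2 + b\<^sup>2 + c\<^sup>2) * ?L (Suc (2 * Suc k)) - (a * b)\<^sup>2 * ?L (Suc (2 * k))) / (a * b) ^ Suc (Suc k)"
    by (simp only: v_value.simps)
  also have "\<dots> = (a\<^sup>2 + b\<^sup>2 + c\<^sup>2) / (a * b) * (?L (Suc (2 * Suc k)) / (a * b) ^ Suc k) -
      ?L (Suc (2 * k)) / (a * b) ^ k"
    using pos by (simp add: diff_divide_distrib power2_eq_square del: ladder_value.simps)
  finally show ?thesis by (simp only: Suc v_value.simps)
qed

end

section \<open>Limits and continued fractions at a positive point\<close>

theorem theorem7p3:
  fixes x1 x2 x3 :: real
  assumes "x1 > 0" and "x2 > 0" and "x3 > 0"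
  shows
    "let x1' = (x2\<^sup>2 + x3\<^sup>2) / x1;
         val = rat_eval x1 x2 x3;
         \<alpha> = (x1' - x1 + sqrt ((x1' - x1)\<^sup>2 + 4 * x3\<^sup>2)) / (2 * x3);
         \<beta> = (x1' + x1 + sqrt ((x1' - x1)\<^sup>2 + 4 * x3\<^sup>2)) / (2 * x2);
         z = (x1' - x1) / x3
     in (\<lambda>i. val (torus_u i) / val (torus_v i)) \<longlonglongrightarrow> \<alpha> \<and>
        (\<lambda>i. val (torus_u i) / val (torus_u (i - 1))) \<longlonglongrightarrow> \<beta> \<and>
        \<beta> = (x3 * \<alpha> + x1) / x2 \<and>
        (z > 0 \<longrightarrow> has_cfrac (\<lambda>_. z) \<alpha>) \<and>
        (z < 0 \<longrightarrow> has_cfrac (\<lambda>n. if n = 0 then 0 else - z) \<alpha>) \<and>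
        (z > 0 \<longrightarrow> has_cfrac (\<lambda>_. (x2\<^sup>2 + x3\<^sup>2 - x1\<^sup>2) / (x1 * x3)) \<alpha>) \<and>
        (z < 0 \<longrightarrow>
           has_cfrac (\<lambda>n. if n = 0 then 0 else (x1\<^sup>2 - x2\<^sup>2 - x3\<^sup>2) / (x1 * x3)) \<alpha>)"
proof -
  define d where "d = (x2\<^sup>2 + x3\<^sup>2) / x1 - x1"
  define D where "D = sqrt (d\<^sup>2 + 4 * x3\<^sup>2)"
  define t where "t = (x2\<^sup>2 + x3\<^sup>2) / x1 + x1"
  define \<alpha> where "\<alpha> = (d + D) / (2 * x3)"
  define \<beta> where "\<beta> = (t + D) / (2 * x2)"
  \<comment> \<open>The conjugate of \<beta>, to serve as the second root of the recurrence shared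
    by \<open>u_value\<close> and \<open>v_value\<close>.\<close>
  define \<mu> where "\<mu> = (t - D) / (2 * x2)"
  define z where "z = d / x3"
  note pos = assms
  have D2: "D\<^sup>2 = d\<^sup>2 + 4 * x3\<^sup>2" by (simp add: D_def)
  \<comment> \<open>As \<open>t\<close> and \<open>d\<close> are the sum and difference of
    \<open>x1'\<close> and \<open>x1\<close>, \<open>t\<^sup>2 - d\<^sup>2 = 4 * x1 * x1' = 4 *
    (x2\<^sup>2 + x3\<^sup>2)\<close>.\<close>
  have D2': "D\<^sup>2 = t\<^sup>2 - 4 * x2\<^sup>2"
    unfolding D2 d_def t_def using pos by (simp add: field_simps power2_eq_square)
  have D: "D > \<bar>d\<bar>"
    unfolding D_def by (rule real_less_rsqrt) (use pos in simp)
  have t: "t > 0" unfolding t_def using pos by (simp add: add_pos_pos)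
  have sum: "\<beta> + \<mu> = (x1\<^sup>2 + x2\<^sup>2 + x3\<^sup>2) / (x1 * x2)"
    unfolding \<beta>_def \<mu>_def t_def using pos by (simp add: field_simps power2_eq_square)
  have "\<beta> * \<mu> = (t\<^sup>2 - D\<^sup>2) / (4 * x2\<^sup>2)"
    unfolding \<beta>_def \<mu>_def by (simp add: field_simps power2_eq_square)
  then have prod: "\<beta> * \<mu> = 1" unfolding D2' using pos by simp
  have less: "\<bar>\<mu>\<bar> < \<bar>\<beta>\<bar>"
    unfolding \<beta>_def \<mu>_def using pos t D by (simp add: abs_divide divide_strict_right_mono)
  have u: "u_value x1 x2 x3 (Suc (Suc n)) =
      (\<beta> + \<mu>) * u_value x1 x2 x3 (Suc n) - \<beta> * \<mu> * u_value x1 x2 x3 n" for n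
    unfolding sum prod using u_value_recurrence[OF pos] by simp
  have v: "v_value x1 x2 x3 (Suc (Suc n)) =
      (\<beta> + \<mu>) * v_value x1 x2 x3 (Suc n) - \<beta> * \<mu> * v_value x1 x2 x3 n" for n
    unfolding sum prod using v_value_recurrence[OF pos] by simp
  \<comment> \<open>The quotient of the coefficients of \<open>\<beta> ^ n\<close>. Since
    \<open>v_value\<close> starts with 0 and \<open>x3\<close>, it equals
    \<open>(x1' - \<mu> * x2) / x3\<close>.\<close>
  have \<alpha>: "(u_value x1 x2 x3 1 - \<mu> * u_value x1 x2 x3 0) /
      (v_value x1 x2 x3 1 - \<mu> * v_value x1 x2 x3 0) = \<alpha>"
    unfolding \<mu>_def \<alpha>_def t_def d_def using pos by (simp add: field_simps)
  have \<alpha>_pos: "\<alpha> > 0"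
    unfolding \<alpha>_def using D pos by simp
  have "(\<lambda>n. u_value x1 x2 x3 n / v_value x1 x2 x3 n) \<longlonglongrightarrow> \<alpha>"
    unfolding \<alpha>[symmetric] using u v less
    by (rule linear_recurrence_ratio_limit) (use pos in simp)
  \<comment> \<open>Index 0 is dropped because \<open>v_value\<close> is matched with
    \<open>torus_v\<close> only from index 1 on.\<close>
  then have "(\<lambda>n. u_value x1 x2 x3 (Suc n) / v_value x1 x2 x3 (Suc n)) \<longlonglongrightarrow> \<alpha>"
    by (rule LIMSEQ_Suc)
  then have "(\<lambda>n. rat_eval x1 x2 x3 (torus_u (Suc n)) / rat_eval x1 x2 x3 (torus_v (Suc n)))
      \<longlonglongrightarrow> \<alpha>"
    by (simp only: rat_eval_eqI[OF has_value_torus_u[OF pos]]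
        rat_eval_eqI[OF has_value_torus_v[OF pos]])
  then have part_a: "(\<lambda>n. rat_eval x1 x2 x3 (torus_u n) / rat_eval x1 x2 x3 (torus_v n)) \<longlonglongrightarrow> \<alpha>"
    by (rule LIMSEQ_imp_Suc)
  \<comment> \<open>Equality would make the quotient above, hence \<alpha>, equal to 0.\<close>
  have "u_value x1 x2 x3 1 \<noteq> \<mu> * u_value x1 x2 x3 0"
    using \<alpha> \<alpha>_pos by auto
  with u less have "(\<lambda>n. u_value x1 x2 x3 (Suc n) / u_value x1 x2 x3 n) \<longlonglongrightarrow> \<beta>"
    by (rule linear_recurrence_successive_ratio_limit)
  \<comment> \<open>Starting at \<open>Suc n\<close> avoids the truncated subtraction
    \<open>0 - 1 = 0\<close>.\<close>
  then have "(\<lambda>n. rat_eval x1 x2 x3 (torus_u (Suc n)) / rat_eval x1 x2 x3 (torus_u (Suc n - 1)))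
      \<longlonglongrightarrow> \<beta>"
    by (simp only: rat_eval_eqI[OF has_value_torus_u[OF pos]] diff_Suc_1)
  then have part_b: "(\<lambda>n. rat_eval x1 x2 x3 (torus_u n) / rat_eval x1 x2 x3 (torus_u (n - 1)))
      \<longlonglongrightarrow> \<beta>"
    by (rule LIMSEQ_imp_Suc)
  have \<beta>_\<alpha>: "\<beta> = (x3 * \<alpha> + x1) / x2"
    unfolding \<beta>_def \<alpha>_def t_def d_def using pos by (simp add: field_simps)
  have root: "\<alpha>\<^sup>2 = z * \<alpha> + 1"
  proof -
    have "\<alpha>\<^sup>2 - z * \<alpha> = (D\<^sup>2 - d\<^sup>2) / (4 * x3\<^sup>2)"
      unfolding \<alpha>_def z_def using pos by (simp add: field_simps power2_eq_square)
    then show ?thesis unfolding D2 using pos by simp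
  qed
  have part_c1: "has_cfrac (\<lambda>_. z) \<alpha>" if "z > 0"
    using that \<alpha>_pos root by (rule has_cfrac_constant)
  have part_c2: "has_cfrac (\<lambda>n. if n = 0 then 0 else - z) \<alpha>" if "z < 0"
  proof -
    \<comment> \<open>Inversion exchanges the signs of \<open>z\<close>: \<open>1 / \<alpha>\<close>
      is the positive root of \<open>X^2 + z X - 1\<close>, so the constant case applies to it with
      \<open>- z\<close>.\<close>
    have "1 / \<alpha> = \<alpha> - z"
      using root \<alpha>_pos by (simp add: field_simps power2_eq_square)
    then have "(1 / \<alpha>)\<^sup>2 = (1 / \<alpha>) * (\<alpha> - z)" by (simp only: power2_eq_square)
    then have "(1 / \<alpha>)\<^sup>2 = - z * (1 / \<alpha>) + 1"
      using \<alpha>_pos by (simp add: right_diff_distrib)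
    then have "has_cfrac (\<lambda>_. - z) (1 / \<alpha>)"
      using that \<alpha>_pos by (intro has_cfrac_constant) auto
    then show ?thesis
      using has_cfrac_0_constant[of "- z" "1 / \<alpha>"] \<alpha>_pos by simp
  qed
  have z_eq: "(x2\<^sup>2 + x3\<^sup>2 - x1\<^sup>2) / (x1 * x3) = z" "(x1\<^sup>2 - x2\<^sup>2 - x3\<^sup>2) / (x1 * x3) = - z"
    unfolding z_def d_def using pos by (simp_all add: field_simps power2_eq_square)
  show ?thesis
    unfolding Let_def z_eq d_def[symmetric] t_def[symmetric] D_def[symmetric]
      z_def[symmetric] \<alpha>_def[symmetric] \<beta>_def[symmetric]
    using part_a part_b \<beta>_\<alpha> part_c1 part_c2 by blast
qed

end
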